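(* Let $n,t\ge 1$ be integers and assume that $\rho_{AB}\in \mathrm{DPS}^{(t)}_n$ with $\mathrm{DPS}^{(t)}$-certificate $\rho_{AB[t]}$. Then $\Pi_{\mathrm{CLDUI}_n}(\rho_{AB})\in \mathrm{DPS}^{(t)}_n$ with $\mathrm{DPS}^{(t)}$-certificate $\Pi_{\mathrm{CLDUI}^{(t)}_n}(\rho_{AB[t]})$. Therefore, if in addition $\rho_{AB}\in\mathrm{CLDUI}_n$, then $\rho_{AB}$ admits a $\mathrm{DPS}^{(t)}$-certificate that belongs to $\mathrm{CLDUI}^{(t)}_n$.
   Context: $\mathrm{Herm}(V)$ denotes the Hermitian matrices acting on $V$. Matrices in $\mathrm{Herm}(\mathbb C^n\otimes(\mathbb C^n)^{\otimes t})$ are indexed by sequences $i_0\underline i$ with $i_0\in[n]$, $\underline i=i_1\ldots i_t\in[n]^t$. For $\sigma\in\mathfrak S_t$, $\underline i^\sigma=i_{\sigma(1)}\ldots i_{\sigma(t)}$. For $\rho\in\mathrm{Herm}(\mathbb C^n\otimes(\mathbb C^n)^{\otimes t})$ and $0\le s\le t$, the partial transpose $\rho^{T_{B[s]}}$ (with respect to the first $s$ of the last $t$ tensor factors) has entries $(\rho^{T_{B[s]}})_{i_0\underline h\,\underline i,\ j_0\underline k\,\underline j}=\rho_{i_0\underline k\,\underline i,\ j_0\underline h\,\underline j}$ for $i_0,j_0\in[n]$, $\underline h,\underline k\in[n]^s$, $\underline i,\underline j\in[n]^{t-s}$ (no transpose for $s=0$). The partial trace is $\mathrm{Tr}_{B[2:t]}(\rho)\in\mathrm{Herm}(\mathbb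 C^n\otimes\mathbb C^n)$, $(\mathrm{Tr}_{B[2:t]}(\rho))_{ij,kl}=\sum_{\underline h\in[n]^{t-1}}\rho_{ij\underline h,\,kl\underline h}$. A $\mathrm{DPS}^{(t)}$-certificate for $\rho_{AB}\in\mathrm{Herm}(\mathbb C^n\otimes\mathbb C^n)$ is a matrix $\rho_{AB[t]}\in\mathrm{Herm}(\mathbb C^n\otimes(\mathbb C^n)^{\otimes t})$ such that: (1) $(\rho_{AB[t]})_{i_0\underline i,j_0\underline j}=(\rho_{AB[t]})_{i_0\underline i,j_0\underline j^\sigma}$ for all $\sigma\in\mathfrak S_t$ and all indices; (2) $\rho_{AB[t]}^{T_{B[s]}}\succeq 0$ for all $s=0,1,\ldots,t$; (3) $\mathrm{Tr}_{B[2:t]}(\rho_{AB[t]})=\rho_{AB}$. $\mathrm{DPS}^{(t)}_n$ is the set of $\rho_{AB}$ having a $\mathrm{DPS}^{(t)}$-certificate. $\mathcal{DU}_n$ is the group of diagonal unitary $n\times n$ matrices. $\mathrm{CLDUI}^{(t)}_n$ is the set of $\rho\in\mathrm{Herm}(\mathbb C^n\otimes(\mathbb C^n)^{\otimes t})$ with $\rho=(U\otimes\overline U^{\otimes t})\rho(U\otimes\overline U^{\otimes t})^*$ for all $U\in\mathcal{DU}_n$, and $\mathrm{CLDUI}_n=\mathrm{CLDUI}^{(1)}_n$. The (orthogonal) projection onto it is $\Pi_{\mathrm{CLDUI}^{(t)}_n}(\rho)=\int_{\mathcal{DU}_n}(U\otimes\overline U^{\otimes t})\rho(U\otimes\overline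 U^{\otimes t})^*\,dU$ (Haar probability measure), and $\Pi_{\mathrm{CLDUI}_n}=\Pi_{\mathrm{CLDUI}^{(1)}_n}$. *)

theory Defs
  imports "HOL-Probability.Probability" "HOL-Combinatorics.Permutations"
begin

text \<open>
  The index set \<open>[n]\<close> is a finite type \<open>'n\<close>. A matrix acting on
  \<open>\<complex>\<^sup>n \<otimes> (\<complex>\<^sup>n)\<^bsup>\<otimes>t\<^esup>\<close> is a function of two multi-indices \<open>(i\<^sub>0, i)\<close> with \<open>i\<close> a list
  of length \<open>t\<close>. All matrices for this \<open>t\<close> vanish off these indices, so that equality of
  matrices is equality of functions. Bipartite matrices on \<open>\<complex>\<^sup>n \<otimes> \<complex>\<^sup>n\<close> are the case \<open>t = 1\<close>,
  with the index pair \<open>ij\<close> written \<open>(i, [j])\<close>.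
\<close>

type_synonym 'n midx = "'n \<times> 'n list"
type_synonym 'n mmat = "'n midx \<Rightarrow> 'n midx \<Rightarrow> complex"

definition midxs :: "nat \<Rightarrow> 'n midx set" where
  "midxs t = {(i0, i). length i = t}"

definition mmats :: "nat \<Rightarrow> 'n mmat set" where
  "mmats t = {A. \<forall>a b. a \<notin> midxs t \<or> b \<notin> midxs t \<longrightarrow> A a b = 0}"

definition mmat_mult :: "nat \<Rightarrow> 'n mmat \<Rightarrow> 'n mmat \<Rightarrow> 'n mmat" where
  "mmat_mult t A B = (\<lambda>a b. \<Sum>c\<in>midxs t. A a c * B c b)"

definition mmat_adj :: "'n mmat \<Rightarrow> 'n mmat" where
  "mmat_adj A = (\<lambda>a b. cnj (A b a))"

definition Herm :: "nat \<Rightarrow> 'n mmat set" where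
  "Herm t = {A \<in> mmats t. mmat_adj A = A}"

text \<open>For a Hermitian matrix the quadratic form is real, so taking the real part loses nothing.\<close>

definition psd :: "nat \<Rightarrow> 'n mmat \<Rightarrow> bool" where
  "psd t A \<longleftrightarrow> A \<in> Herm t \<and>
     (\<forall>v :: 'n midx \<Rightarrow> complex. 0 \<le> Re (\<Sum>a\<in>midxs t. \<Sum>b\<in>midxs t. cnj (v a) * A a b * v b))"

definition partial_transpose :: "nat \<Rightarrow> nat \<Rightarrow> 'n mmat \<Rightarrow> 'n mmat" where
  "partial_transpose t s \<rho> = (\<lambda>(i0, x) (j0, y).
     if length x = t \<and> length y = t
     then \<rho> (i0, take s y @ drop s x) (j0, take s x @ drop s y) else 0)"

definition partial_trace :: "nat \<Rightarrow> 'n mmat \<Rightarrow> 'n mmat" where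
  "partial_trace t \<rho> = (\<lambda>(i, x) (k, y).
     if length x = 1 \<and> length y = 1
     then \<Sum>h | length h = t - 1. \<rho> (i, x @ h) (k, y @ h) else 0)"

text \<open>Tensor positions are numbered from 0, so \<open>permute_list \<sigma> j\<close> is \<open>j\<^sup>\<sigma>\<close>.\<close>

definition DPS_certificate :: "nat \<Rightarrow> 'n mmat \<Rightarrow> 'n mmat \<Rightarrow> bool" where
  "DPS_certificate t \<rho>AB \<rho> \<longleftrightarrow>
     \<rho>AB \<in> Herm 1 \<and> \<rho> \<in> Herm t \<and>
     (\<forall>\<sigma> i0 i j0 j. \<sigma> permutes {..<t} \<and> length i = t \<and> length j = t \<longrightarrow>
        \<rho> (i0, i) (j0, j) = \<rho> (i0, i) (j0, permute_list \<sigma> j)) \<and>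
     (\<forall>s\<le>t. psd t (partial_transpose t s \<rho>)) \<and>
     partial_trace t \<rho> = \<rho>AB"

definition DPS :: "nat \<Rightarrow> 'n mmat set" where
  "DPS t = {\<rho>AB \<in> Herm 1. \<exists>\<rho>. DPS_certificate t \<rho>AB \<rho>}"

definition DU :: "(complex ^ 'n ^ 'n) set" where
  "DU = {U. (\<forall>i j. i \<noteq> j \<longrightarrow> U $ i $ j = 0) \<and>
            U ** transpose (map_matrix cnj U) = mat 1 \<and>
            transpose (map_matrix cnj U) ** U = mat 1}"

text \<open>The matrix \<open>U \<otimes> \<close>(conjugate of \<open>U\<close>)\<open>\<^bsup>\<otimes>t\<^esup>\<close>.\<close>

definition U_tensor :: "nat \<Rightarrow> complex ^ 'n ^ 'n \<Rightarrow> 'n mmat" where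
  "U_tensor t U = (\<lambda>(i0, i) (j0, j).
     if length i = t \<and> length j = t
     then U $ i0 $ j0 * (\<Prod>r<t. cnj (U $ (i ! r) $ (j ! r))) else 0)"

definition U_conj :: "nat \<Rightarrow> complex ^ 'n ^ 'n \<Rightarrow> 'n mmat \<Rightarrow> 'n mmat" where
  "U_conj t U \<rho> = mmat_mult t (mmat_mult t (U_tensor t U) \<rho>) (mmat_adj (U_tensor t U))"

definition CLDUI :: "nat \<Rightarrow> ('n::finite) mmat set" where
  "CLDUI t = {\<rho> \<in> Herm t. \<forall>U\<in>DU. \<rho> = U_conj t U \<rho>}"

text \<open>
  The Haar probability measure on \<open>DU\<close> is the image of the product of the uniform measures on
  the unit circle; the lemmas \<open>prob_space_haar_DU\<close> and \<open>haar_DU_invariant\<close> below establish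
  the characterising properties.
\<close>

definition circle_measure :: "complex measure" where
  "circle_measure =
     distr (uniform_measure lborel {0..<2*pi}) (restrict_space borel (sphere 0 1)) cis"

definition diag_mat :: "('n \<Rightarrow> complex) \<Rightarrow> complex ^ 'n ^ 'n" where
  "diag_mat u = (\<chi> i j. if i = j then u i else 0)"

definition haar_DU :: "(complex ^ 'n ^ 'n) measure" where
  "haar_DU = distr (PiM UNIV (\<lambda>_. circle_measure)) (restrict_space borel DU) diag_mat"

definition proj_CLDUI :: "nat \<Rightarrow> ('n::finite) mmat \<Rightarrow> 'n mmat" where
  "proj_CLDUI t \<rho> = (\<lambda>a b. \<integral>U. U_conj t U \<rho> a b \<partial>haar_DU)"

lemma borel_measurable_cis: "cis \<in> borel_measurable borel"
  by (intro borel_measurable_continuous_onI continuous_intros)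

lemma prob_space_circle: "prob_space circle_measure"
proof -
  have "prob_space (uniform_measure lborel {0..<2*pi})"
    by (rule prob_space_uniform_measure) auto
  moreover have "cis \<in> uniform_measure lborel {0..<2*pi} \<rightarrow>\<^sub>M restrict_space borel (sphere 0 1)"
    by (intro measurable_restrict_space2)
      (auto simp: borel_measurable_cis cong: measurable_cong_sets)
  ultimately show ?thesis
    unfolding circle_measure_def by (rule prob_space.prob_space_distr)
qed

lemma sets_circle [measurable_cong, simp]: "sets circle_measure = sets (restrict_space borel (sphere 0 1))"
  and space_circle [simp]: "space circle_measure = sphere 0 1"
  by (simp_all add: circle_measure_def space_restrict_space)

lemma periodic_nn_integral_shift:
  fixes f :: "real \<Rightarrow> ennreal"
  assumes [measurable]: "f \<in> borel_measurable borel"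
    and per: "\<And>x. f (x + p) = f x" and a: "0 \<le> a" "a < p"
  shows "(\<integral>\<^sup>+x. f (x + a) * indicator {0..<p} x \<partial>lborel) = (\<integral>\<^sup>+x. f x * indicator {0..<p} x \<partial>lborel)"
proof -
  have "(\<integral>\<^sup>+x. f (x + a) * indicator {0..<p} x \<partial>lborel)
      = (\<integral>\<^sup>+x. f (x + a) * indicator {a..<p+a} (x + a) \<partial>lborel)"
    by (intro nn_integral_cong) (auto simp: indicator_def)
  also have "\<dots> = (\<integral>\<^sup>+x. f x * indicator {a..<p+a} x \<partial>lborel)"
    by (subst (2) nn_integral_real_affine[where c = 1 and t = a]) (auto simp: add.commute)
  also have "\<dots> = (\<integral>\<^sup>+x. f x * indicator {a..<p} x + f x * indicator {p..<p+a} x \<partial>lborel)"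
    using a by (intro nn_integral_cong) (auto simp: indicator_def)
  also have "\<dots> = (\<integral>\<^sup>+x. f x * indicator {a..<p} x \<partial>lborel) + (\<integral>\<^sup>+x. f x * indicator {p..<p+a} x \<partial>lborel)"
    by (rule nn_integral_add) auto
  also have "(\<integral>\<^sup>+x. f x * indicator {p..<p+a} x \<partial>lborel)
     = (\<integral>\<^sup>+x. f (p + x) * indicator {p..<p+a} (p + x) \<partial>lborel)"
    by (subst nn_integral_real_affine[where c = 1 and t = p]) auto
  also have "\<dots> = (\<integral>\<^sup>+x. f x * indicator {0..<a} x \<partial>lborel)"
    using per by (intro nn_integral_cong) (auto simp: indicator_def add.commute)
  also have "(\<integral>\<^sup>+x. f x * indicator {a..<p} x \<partial>lborel) + (\<integral>\<^sup>+x. f x * indicator {0..<a} x \<partial>lborel)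
     = (\<integral>\<^sup>+x. f x * indicator {a..<p} x + f x * indicator {0..<a} x \<partial>lborel)"
    by (rule nn_integral_add[symmetric]) auto
  also have "\<dots> = (\<integral>\<^sup>+x. f x * indicator {0..<p} x \<partial>lborel)"
    using a by (intro nn_integral_cong) (auto simp: indicator_def)
  finally show ?thesis .
qed

lemma measurable_rot:
  assumes "w \<in> sphere 0 (1::real)"
  shows "(\<lambda>z::complex. w * z) \<in> circle_measure \<rightarrow>\<^sub>M circle_measure"
proof -
  have "(\<lambda>z. w * z) \<in> restrict_space borel (sphere 0 1) \<rightarrow>\<^sub>M restrict_space borel (sphere 0 1)"
    using assms by (intro measurable_restrict_space2 measurable_restrict_space1)
      (auto simp: space_restrict_space norm_mult)
  thus ?thesis by (simp cong: measurable_cong_sets)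
qed

lemma circle_measure_invariant:
  assumes w: "w \<in> sphere 0 (1::real)"
  shows "distr circle_measure circle_measure (\<lambda>z. w * z) = circle_measure"
proof (rule measure_eqI)
  fix A assume "A \<in> sets (distr circle_measure circle_measure (\<lambda>z. w * z))"
  hence A: "A \<in> sets (restrict_space borel (sphere 0 1))" by simp
  hence A': "A \<in> sets borel" "A \<subseteq> sphere 0 1"
    by (auto simp: sets_restrict_space_iff)
  define a where "a = Arg2pi w"
  have a: "0 \<le> a" "a < 2*pi" "w = cis a"
    using w Arg2pi[of w] by (auto simp: a_def cis_conv_exp is_Arg_def)
  have c: "cis \<in> uniform_measure lborel {0..<2*pi} \<rightarrow>\<^sub>M restrict_space borel (sphere 0 1)"
    by (intro measurable_restrict_space2)
      (auto simp: borel_measurable_cis cong: measurable_cong_sets)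
  have [measurable]: "cis \<in> borel_measurable borel" by (rule borel_measurable_cis)
  note A'(1) [measurable]
  have E: "emeasure (uniform_measure lborel {0..<2*pi}) (cis -` B) =
      (\<integral>\<^sup>+x. indicator B (cis x) * indicator {0..<2*pi} x \<partial>lborel) / emeasure lborel {0..<2*pi}"
    if [measurable]: "B \<in> sets borel" for B
  proof -
    have m: "cis -` B \<in> sets borel"
      using measurable_sets_borel[of cis borel B] by auto
    have "(\<integral>\<^sup>+x. indicator B (cis x) * indicator {0..<2*pi} x \<partial>lborel)
       = (\<integral>\<^sup>+x. indicator ({0..<2*pi} \<inter> cis -` B) x \<partial>lborel)"
      by (intro nn_integral_cong) (auto simp: indicator_def)
    also have "\<dots> = emeasure lborel ({0..<2*pi} \<inter> cis -` B)"
      using m by (intro nn_integral_indicator) auto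
    finally show ?thesis using m by simp
  qed
  let ?B = "(\<lambda>z. w * z) -` A"
  have B: "?B \<in> sets borel"
    using measurable_sets_borel[of "\<lambda>z. w * z" borel A] A' by auto
  have B': "?B \<inter> sphere 0 1 \<in> sets (restrict_space borel (sphere 0 1))"
    using B by (auto simp: sets_restrict_space)
  have v: "cis -` (?B \<inter> sphere 0 1) = cis -` ?B" by auto
  have "emeasure (distr circle_measure circle_measure (\<lambda>z. w * z)) A
      = emeasure circle_measure (?B \<inter> sphere 0 1)"
    using A by (subst emeasure_distr) (auto intro!: measurable_rot w)
  also have "\<dots> = emeasure (uniform_measure lborel {0..<2*pi}) (cis -` ?B)"
    unfolding circle_measure_def by (subst emeasure_distr[OF c B']) (simp only: v, simp)
  also have "\<dots> = (\<integral>\<^sup>+x. indicator A (cis (x + a)) * indicator {0..<2*pi} x \<partial>lborel) / emeasure lborel {0..<2*pi}"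
    by (subst E[OF B]) (simp add: a(3) cis_mult add.commute indicator_def)
  also have "\<dots> = (\<integral>\<^sup>+x. indicator A (cis x) * indicator {0..<2*pi} x \<partial>lborel) / emeasure lborel {0..<2*pi}"
    using a by (subst periodic_nn_integral_shift[where f = "\<lambda>x. indicator A (cis x)"])
      (auto simp flip: cis_mult)
  also have "\<dots> = emeasure (uniform_measure lborel {0..<2*pi}) (cis -` A)"
    using E[OF A'(1)] by simp
  also have "\<dots> = emeasure circle_measure A"
    unfolding circle_measure_def by (subst emeasure_distr[OF c A]) simp
  finally show "emeasure (distr circle_measure circle_measure (\<lambda>z. w * z)) A = emeasure circle_measure A" .
qed simp

lemma diag_mat_mult: "diag_mat u ** diag_mat v = diag_mat (\<lambda>i. u i * v i)"
  for u :: "'n::finite \<Rightarrow> complex"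
proof -
  have "(\<Sum>k\<in>UNIV. (if i = k then u i else 0) * (if k = j then v k else 0))
      = (if i = j then u i * v i else 0)" for i j
  proof -
    have "(\<Sum>k\<in>UNIV. (if i = k then u i else 0) * (if k = j then v k else 0))
      = (\<Sum>k\<in>UNIV. if i = k then (if i = j then u i * v i else 0) else 0)"
      by (intro sum.cong) auto
    thus ?thesis by simp
  qed
  thus ?thesis by (simp add: diag_mat_def matrix_matrix_mult_def vec_eq_iff)
qed

lemma DU_iff: "U \<in> DU \<longleftrightarrow> (\<exists>u. (\<forall>i. norm (u i) = 1) \<and> U = diag_mat u)"
  for U :: "complex ^ 'n::finite ^ 'n"
proof
  assume U: "U \<in> DU"
  have d: "U $ i $ j = 0" if "i \<noteq> j" for i j using U that by (simp add: DU_def)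
  have "norm (U $ i $ i) = 1" for i
  proof -
    have "(U ** transpose (map_matrix cnj U)) $ i $ i = 1"
      using U by (simp add: DU_def mat_def)
    also have "(U ** transpose (map_matrix cnj U)) $ i $ i = (\<Sum>k\<in>UNIV. U $ i $ k * cnj (U $ i $ k))"
      by (simp add: matrix_matrix_mult_def transpose_def map_matrix_def)
    also have "\<dots> = (\<Sum>k\<in>UNIV. if k = i then U $ i $ i * cnj (U $ i $ i) else 0)"
      by (intro sum.cong) (auto simp: d)
    also have "\<dots> = of_real ((norm (U $ i $ i))\<^sup>2)"
      by (simp only: complex_norm_square) simp
    finally have "(norm (U $ i $ i))\<^sup>2 = 1" by (simp only: of_real_eq_1_iff)
    thus ?thesis by (simp add: power2_eq_1_iff) (smt (verit) norm_ge_zero)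
  qed
  moreover have "U = diag_mat (\<lambda>i. U $ i $ i)"
    by (auto simp: vec_eq_iff diag_mat_def d)
  ultimately show "\<exists>u. (\<forall>i. norm (u i) = 1) \<and> U = diag_mat u" by (intro exI[of _ "\<lambda>i. U $ i $ i"]) auto
next
  assume "\<exists>u. (\<forall>i. norm (u i) = 1) \<and> U = diag_mat u"
  then obtain u where u: "\<And>i. norm (u i) = 1" "U = diag_mat u" by auto
  have 1: "u i * cnj (u i) = 1" for i
    using u(1)[of i] by (metis complex_norm_square of_real_1 power_one)
  have 2: "transpose (map_matrix cnj U) = diag_mat (\<lambda>i. cnj (u i))"
    by (simp add: u(2) diag_mat_def transpose_def map_matrix_def vec_eq_iff)
  have 3: "diag_mat (\<lambda>_::'n. 1) = mat 1"
    by (simp add: diag_mat_def mat_def)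
  have "diag_mat u ** diag_mat (\<lambda>i. cnj (u i)) = mat 1"
       "diag_mat (\<lambda>i. cnj (u i)) ** diag_mat u = mat 1"
    by (simp_all add: diag_mat_mult 1 3 mult.commute[of "cnj _"])
  moreover have "\<forall>i j. i \<noteq> j \<longrightarrow> U $ i $ j = 0"
    by (simp add: u(2) diag_mat_def)
  ultimately show "U \<in> DU"
    by (simp add: DU_def 2) (simp add: u(2))
qed

lemma measurable_diag_mat:
  "(diag_mat :: ('n::finite \<Rightarrow> complex) \<Rightarrow> _) \<in> PiM UNIV (\<lambda>_. circle_measure) \<rightarrow>\<^sub>M restrict_space borel DU"
proof (rule measurable_restrict_space2)
  show "diag_mat \<in> space (PiM UNIV (\<lambda>_::'n. circle_measure)) \<rightarrow> DU"
    by (auto simp: space_PiM DU_iff PiE_def Pi_def)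
  have [measurable]: "(\<lambda>u. u i) \<in> borel_measurable (PiM UNIV (\<lambda>_::'n. circle_measure))" for i
  proof -
    have "(\<lambda>u. u i) \<in> PiM UNIV (\<lambda>_::'n. circle_measure) \<rightarrow>\<^sub>M circle_measure" by measurable
    hence "(\<lambda>u. u i) \<in> PiM UNIV (\<lambda>_::'n. circle_measure) \<rightarrow>\<^sub>M restrict_space borel (sphere 0 1)"
      by (simp cong: measurable_cong_sets)
    thus ?thesis by (simp add: measurable_restrict_space2_iff)
  qed
  have "(\<lambda>u. diag_mat u \<bullet> b) \<in> borel_measurable (PiM UNIV (\<lambda>_::'n. circle_measure))" for b
  proof -
    have "(\<lambda>u. diag_mat u \<bullet> b) = (\<lambda>u. \<Sum>i\<in>UNIV. \<Sum>j\<in>UNIV. (if i = j then u i else 0) \<bullet> (b $ i $ j))"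
      by (auto simp: inner_vec_def diag_mat_def)
    thus ?thesis by simp
  qed
  thus "diag_mat \<in> borel_measurable (PiM UNIV (\<lambda>_::'n. circle_measure))"
    by (subst borel_measurable_euclidean_space) auto
qed

lemma prob_space_haar_DU: "prob_space (haar_DU :: (complex ^ 'n::finite ^ 'n) measure)"
proof -
  interpret product_prob_space "\<lambda>_::'n. circle_measure" UNIV
    by (intro product_prob_spaceI prob_space_circle)
  show ?thesis unfolding haar_DU_def
    by (intro prob_space_distr measurable_diag_mat)
qed

lemma space_haar_DU [simp]: "space haar_DU = DU"
  and sets_haar_DU [measurable_cong, simp]: "sets haar_DU = sets (restrict_space borel DU)"
  by (simp_all add: haar_DU_def space_restrict_space)

lemma PiM_circle_invariant:
  fixes w :: "'n::finite \<Rightarrow> complex"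
  assumes w: "\<And>i. norm (w i) = 1"
  defines "P \<equiv> PiM UNIV (\<lambda>_::'n. circle_measure)"
  shows "distr P P (\<lambda>u i. w i * u i) = P"
    and "(\<lambda>u i. w i * u i) \<in> P \<rightarrow>\<^sub>M P"
proof -
  interpret product_prob_space "\<lambda>_::'n. circle_measure" UNIV
    by (intro product_prob_spaceI prob_space_circle)
  have rot: "(\<lambda>z. w i * z) \<in> circle_measure \<rightarrow>\<^sub>M circle_measure" for i
    by (rule measurable_rot) (use w in auto)
  show m: "(\<lambda>u i. w i * u i) \<in> P \<rightarrow>\<^sub>M P"
  proof -
    have "(\<lambda>u. \<lambda>i\<in>UNIV. w i * u i) \<in> P \<rightarrow>\<^sub>M P"
      unfolding P_def
      by (intro measurable_restrict measurable_compose[OF measurable_component_singleton])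
        (auto intro: rot)
    thus ?thesis by (simp add: restrict_UNIV)
  qed
  have "P = distr P P (\<lambda>u i. w i * u i)"
    unfolding P_def
  proof (rule PiM_eqI[symmetric], goal_cases)
    case (3 A)
    have A: "A i \<in> sets circle_measure" for i using 3 by auto
    let ?B = "\<lambda>i. (\<lambda>z. w i * z) -` A i \<inter> space circle_measure"
    have "emeasure (distr P P (\<lambda>u i. w i * u i)) (Pi\<^sub>E UNIV A)
       = emeasure P ((\<lambda>u i. w i * u i) -` (Pi\<^sub>E UNIV A) \<inter> space P)"
      using A by (subst emeasure_distr[OF m]) (auto simp: P_def intro!: sets_PiM_I_finite)
    also have "(\<lambda>u i. w i * u i) -` (Pi\<^sub>E UNIV A) \<inter> space P = Pi\<^sub>E UNIV ?B"
      by (auto simp: P_def space_PiM PiE_def Pi_def)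
    also have "emeasure P (Pi\<^sub>E UNIV ?B) = (\<Prod>i\<in>UNIV. emeasure circle_measure (?B i))"
      unfolding P_def by (rule emeasure_PiM) (rule finite, rule measurable_sets[OF rot A])
    also have "\<dots> = (\<Prod>i\<in>UNIV. emeasure (distr circle_measure circle_measure (\<lambda>z. w i * z)) (A i))"
      by (intro prod.cong refl emeasure_distr[OF rot A, symmetric])
    also have "\<dots> = (\<Prod>i\<in>UNIV. emeasure circle_measure (A i))"
      using w by (simp add: circle_measure_invariant)
    finally show ?case by (simp add: P_def)
  qed auto
  thus "distr P P (\<lambda>u i. w i * u i) = P" by simp
qed

lemma haar_DU_invariant:
  fixes V :: "complex ^ 'n::finite ^ 'n"
  assumes "V \<in> DU"
  shows "distr haar_DU haar_DU (\<lambda>U. V ** U) = haar_DU"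
proof -
  let ?P = "PiM UNIV (\<lambda>_::'n. circle_measure)"
  let ?D = "restrict_space borel DU :: (complex ^ 'n ^ 'n) measure"
  obtain w where w: "\<And>i. norm (w i) = 1" and V: "V = diag_mat w"
    using assms by (auto simp: DU_iff)
  have "continuous_on UNIV (\<lambda>U. V ** U)"
    by (auto simp: matrix_matrix_mult_def intro!: continuous_intros)
  hence mV: "(\<lambda>U. V ** U) \<in> ?D \<rightarrow>\<^sub>M ?D"
  proof (intro measurable_restrict_space2 measurable_restrict_space1 borel_measurable_continuous_onI)
    show "(**) V \<in> space ?D \<rightarrow> DU"
    proof
      fix U assume "U \<in> space ?D"
      then obtain u where "\<And>i. norm (u i) = 1" "U = diag_mat u"
        by (auto simp: space_restrict_space DU_iff)
      thus "V ** U \<in> DU"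
        using w by (auto simp: V diag_mat_mult DU_iff norm_mult intro!: exI[of _ "\<lambda>i. w i * u i"])
    qed
  qed auto
  have "distr haar_DU haar_DU (\<lambda>U. V ** U) = distr haar_DU ?D (\<lambda>U. V ** U)"
    by (intro distr_cong) auto
  also have "\<dots> = distr ?P ?D (\<lambda>u. V ** diag_mat u)"
    unfolding haar_DU_def by (subst distr_distr[OF mV measurable_diag_mat]) (simp add: comp_def)
  also have "\<dots> = distr ?P ?D (diag_mat \<circ> (\<lambda>u i. w i * u i))"
    by (simp add: V diag_mat_mult comp_def)
  also have "\<dots> = distr (distr ?P ?P (\<lambda>u i. w i * u i)) ?D diag_mat"
    by (intro distr_distr[symmetric] measurable_diag_mat PiM_circle_invariant w)
  also have "\<dots> = haar_DU"
    using w by (simp add: PiM_circle_invariant(1) haar_DU_def)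
  finally show ?thesis .
qed

end

theory Submission
  imports Defs
begin

text \<open>
  For a diagonal unitary \<open>U\<close>, conjugation by \<open>U\<close> tensor the conjugates of \<open>U\<close> multiplies the
  \<open>(a, b)\<close> entry of a matrix by \<open>w a * cnj (w b)\<close> for a phase \<open>w\<close>, so the projection is the
  entrywise product with the averaged kernel \<open>\<integral> w a * cnj (w b)\<close>. Transposing the first \<open>s\<close>
  factors only conjugates the phases at those positions, hence turns this kernel into another one
  of the same Gram form, and entrywise multiplication by such a kernel preserves positivity.
  Phases are permutation invariant, and the phases of the traced-out factors cancel. Invariance of
  the Haar measure makes the kernel, and thus the projection, invariant.
\<close>

section \<open>Phases of diagonal unitaries and their Haar averages\<close>

text \<open>These are the diagonal entries of the tensor product of \<open>U\<close>,
  \<open>s\<close> further copies of \<open>U\<close>, and conjugates of \<open>U\<close> in the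
  remaining positions. The case \<open>s = 0\<close> belongs to \<open>U_tensor\<close>; the
  parameter \<open>s\<close> counts the transposed factors.\<close>

definition diag_phase :: "nat \<Rightarrow> complex ^ 'n ^ 'n \<Rightarrow> 'n midx \<Rightarrow> complex" where
  "diag_phase s U = (\<lambda>(i0, x). U $ i0 $ i0 * prod_list (map (\<lambda>k. U $ k $ k) (take s x)) *
     prod_list (map (\<lambda>k. cnj (U $ k $ k)) (drop s x)))"

text \<open>By orthogonality of characters the values are 0 or 1, but only the integral form is
  used, since it displays the Gram structure and the invariance.\<close>

definition phase_kernel :: "nat \<Rightarrow> ('n::finite) midx \<Rightarrow> 'n midx \<Rightarrow> complex" where
  "phase_kernel s a b = (\<integral>U. diag_phase s U a * cnj (diag_phase s U b) \<partial>haar_DU)"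

lemma finite_midxs: "finite (midxs t :: ('n::finite) midx set)"
proof -
  have "midxs t = UNIV \<times> {x :: 'n list. set x \<subseteq> UNIV \<and> length x = t}"
    by (auto simp: midxs_def)
  thus ?thesis using finite_lists_length_eq[of "UNIV :: 'n set" t] by simp
qed

lemma norm_DU_diag: "U \<in> DU \<Longrightarrow> norm (U $ k $ k) = 1" for U :: "complex ^ 'n::finite ^ 'n"
  by (auto simp: DU_iff diag_mat_def)

lemma norm_prod_list_eq_1:
  fixes f :: "'a \<Rightarrow> complex"
  assumes "\<And>k. norm (f k) = 1"
  shows "norm (prod_list (map f x)) = 1"
  using assms by (induction x) (auto simp: norm_mult)

lemma cnj_prod_list_map: "cnj (prod_list (map f x)) = prod_list (map (\<lambda>k. cnj (f k)) x)"
  by (induction x) auto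

lemma norm_diag_phase: "U \<in> DU \<Longrightarrow> norm (diag_phase s U a) = 1"
  for U :: "complex ^ 'n::finite ^ 'n"
  by (cases a) (simp add: diag_phase_def norm_mult norm_DU_diag norm_prod_list_eq_1)

lemma continuous_on_prod_list_map:
  fixes f :: "'a \<Rightarrow> 'b::topological_space \<Rightarrow> complex"
  assumes "\<And>k. continuous_on S (f k)"
  shows "continuous_on S (\<lambda>u. prod_list (map (\<lambda>k. f k u) x))"
  using assms by (induction x) (auto intro!: continuous_intros)

text \<open>The integrand is continuous in \<open>U\<close> and has modulus 1 on \<open>DU\<close>,
  hence is bounded on a probability space.\<close>

lemma integrable_diag_phase:
  "integrable (haar_DU :: (complex ^ 'n::finite ^ 'n) measure)
     (\<lambda>U. diag_phase s U a * cnj (diag_phase s U b))"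
proof -
  interpret prob_space "haar_DU :: (complex ^ 'n::finite ^ 'n) measure"
    by (rule prob_space_haar_DU)
  have c: "continuous_on UNIV (\<lambda>U :: complex ^ 'n ^ 'n. diag_phase s U a)" for a
    unfolding diag_phase_def case_prod_unfold
    by (intro continuous_intros continuous_on_prod_list_map)
  have "(\<lambda>U :: complex ^ 'n ^ 'n. diag_phase s U a * cnj (diag_phase s U b)) \<in> borel_measurable borel"
    by (intro borel_measurable_continuous_onI continuous_intros c)
  hence "(\<lambda>U :: complex ^ 'n ^ 'n. diag_phase s U a * cnj (diag_phase s U b))
      \<in> borel_measurable (restrict_space borel DU)"
    by (rule measurable_restrict_space1)
  hence "(\<lambda>U :: complex ^ 'n ^ 'n. diag_phase s U a * cnj (diag_phase s U b)) \<in> borel_measurable haar_DU"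
    by (simp cong: measurable_cong_sets)
  thus ?thesis
    by (intro integrable_const_bound[where B = 1] AE_I2) (auto simp: norm_mult norm_diag_phase)
qed

section \<open>The projection as entrywise multiplication\<close>

lemma U_tensor_DU:
  fixes U :: "complex ^ 'n::finite ^ 'n"
  assumes "U \<in> DU"
  shows "U_tensor t U a b = (if a = b \<and> a \<in> midxs t then diag_phase 0 U a else 0)"
proof -
  obtain i0 i j0 j where ab: "a = (i0, i)" "b = (j0, j)" by (cases a, cases b)
  have off: "U $ k $ l = 0" if "k \<noteq> l" for k l
    using assms that by (simp add: DU_def)
  show ?thesis
  proof (cases "a = b \<and> a \<in> midxs t")
    case True
    have "(\<Prod>r<t. cnj (U $ (i ! r) $ (i ! r))) = prod_list (map (\<lambda>k. cnj (U $ k $ k)) i)"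
      using True by (auto simp: ab midxs_def prod.list_conv_set_nth atLeast0LessThan)
    thus ?thesis using True by (simp add: ab U_tensor_def diag_phase_def midxs_def)
  next
    case False
    \<comment> \<open>Distinct lists of equal length differ at some position, which picks an
      off-diagonal entry of \<open>U\<close>.\<close>
    have "\<exists>r<t. cnj (U $ (i ! r) $ (j ! r)) = 0" if "length i = t" "length j = t" "i \<noteq> j"
      using that off by (metis complex_cnj_zero nth_equalityI)
    hence "(\<Prod>r<t. cnj (U $ (i ! r) $ (j ! r))) = 0" if "length i = t" "length j = t" "i \<noteq> j"
      using that by (meson finite_lessThan lessThan_iff prod_zero)
    thus ?thesis using False off by (auto simp: ab U_tensor_def midxs_def)
  qed
qed

lemma U_conj_DU:
  fixes U :: "complex ^ 'n::finite ^ 'n"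
  assumes U: "U \<in> DU" and \<rho>: "\<rho> \<in> mmats t"
  shows "U_conj t U \<rho> a b = diag_phase 0 U a * cnj (diag_phase 0 U b) * \<rho> a b"
proof -
  have L: "mmat_mult t (U_tensor t U) \<rho> a c = diag_phase 0 U a * \<rho> a c" for c
  proof -
    have "mmat_mult t (U_tensor t U) \<rho> a c
        = (\<Sum>d\<in>midxs t. if d = a then diag_phase 0 U a * \<rho> a c else 0)"
      unfolding mmat_mult_def by (intro sum.cong) (auto simp: U_tensor_DU[OF U])
    \<comment> \<open>Off the index set the sum has no nonzero term, so the claim there rests on the
      convention that matrices vanish outside \<open>midxs t\<close>.\<close>
    moreover have "\<rho> a c = 0" if "a \<notin> midxs t" using \<rho> that unfolding mmats_def by blast
    ultimately show ?thesis by (auto simp: finite_midxs)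
  qed
  have "U_conj t U \<rho> a b
      = (\<Sum>c\<in>midxs t. if c = b then diag_phase 0 U a * \<rho> a b * cnj (diag_phase 0 U b) else 0)"
    unfolding U_conj_def mmat_mult_def[of t "mmat_mult t (U_tensor t U) \<rho>"] L
    by (intro sum.cong) (auto simp: mmat_adj_def U_tensor_DU[OF U])
  moreover have "\<rho> a b = 0" if "b \<notin> midxs t" using \<rho> that unfolding mmats_def by blast
  ultimately show ?thesis by (auto simp: finite_midxs)
qed

lemma proj_CLDUI_eq:
  fixes \<rho> :: "('n::finite) mmat"
  assumes "\<rho> \<in> mmats t"
  shows "proj_CLDUI t \<rho> a b = phase_kernel 0 a b * \<rho> a b"
proof -
  have "proj_CLDUI t \<rho> a b
      = (\<integral>U. diag_phase 0 U a * cnj (diag_phase 0 U b) * \<rho> a b \<partial>haar_DU)"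
    unfolding proj_CLDUI_def
    by (intro Bochner_Integration.integral_cong refl) (simp add: U_conj_DU[OF _ assms])
  thus ?thesis by (simp add: phase_kernel_def)
qed

section \<open>Hermitian symmetry and positivity\<close>

lemma cnj_phase_kernel: "cnj (phase_kernel s a b) = phase_kernel s b a"
  unfolding phase_kernel_def by (subst Bochner_Integration.integral_cnj[symmetric]) (simp add: mult.commute)

lemma Herm_phase_kernel:
  assumes "A \<in> Herm t"
  shows "(\<lambda>a b. phase_kernel s a b * A a b) \<in> Herm t"
proof -
  have "cnj (A b a) = A a b" for a b
    using assms unfolding Herm_def mmat_adj_def by (auto dest: fun_cong)
  thus ?thesis using assms
    by (auto simp: Herm_def mmats_def mmat_adj_def cnj_phase_kernel fun_eq_iff)
qed

text \<open>The quadratic form of the entrywise product at \<open>v\<close> is the Haar average of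
  the quadratic form of \<open>A\<close> at rescaled copies of \<open>v\<close>.\<close>

lemma psd_phase_kernel:
  fixes A :: "('n::finite) mmat"
  assumes "psd t A"
  shows "psd t (\<lambda>a b. phase_kernel s a b * A a b)"
  unfolding psd_def
proof (intro conjI allI)
  show "(\<lambda>a b. phase_kernel s a b * A a b) \<in> Herm t"
    using assms by (intro Herm_phase_kernel) (simp add: psd_def)
next
  fix v :: "'n midx \<Rightarrow> complex"
  let ?f = "\<lambda>a b U. diag_phase s U a * cnj (diag_phase s U b)"
  let ?q = "\<lambda>U. \<Sum>a\<in>midxs t. \<Sum>b\<in>midxs t. ?f a b U * (cnj (v a) * A a b * v b)"
  have int: "integrable haar_DU ?q"
    by (intro Bochner_Integration.integrable_sum integrable_mult_left impI integrable_diag_phase)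
  have "(\<Sum>a\<in>midxs t. \<Sum>b\<in>midxs t. cnj (v a) * (phase_kernel s a b * A a b) * v b)
      = (\<Sum>a\<in>midxs t. \<Sum>b\<in>midxs t. (\<integral>U. ?f a b U * (cnj (v a) * A a b * v b) \<partial>haar_DU))"
    unfolding phase_kernel_def by (intro sum.cong refl) (simp add: mult_ac)
  also have "\<dots> = (\<integral>U. ?q U \<partial>haar_DU)"
    by (simp add: Bochner_Integration.integral_sum Bochner_Integration.integrable_sum
        integrable_diag_phase)
  finally have eq: "(\<Sum>a\<in>midxs t. \<Sum>b\<in>midxs t. cnj (v a) * (phase_kernel s a b * A a b) * v b)
      = (\<integral>U. ?q U \<partial>haar_DU)" .
  have pos: "0 \<le> Re (?q U)" for U
  proof -
    \<comment> \<open>The phase is conjugated here because the quadratic form conjugates its left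
      argument.\<close>
    let ?w = "\<lambda>a. cnj (diag_phase s U a) * v a"
    have "0 \<le> Re (\<Sum>a\<in>midxs t. \<Sum>b\<in>midxs t. cnj (?w a) * A a b * ?w b)"
      using assms[unfolded psd_def] by (rule conjunct2[THEN spec])
    also have "(\<Sum>a\<in>midxs t. \<Sum>b\<in>midxs t. cnj (?w a) * A a b * ?w b) = ?q U"
      by (intro sum.cong refl) simp
    finally show ?thesis .
  qed
  have "Re (\<integral>U. ?q U \<partial>haar_DU) = (\<integral>U. Re (?q U) \<partial>haar_DU)"
    using int by (rule integral_Re[symmetric])
  also have "\<dots> \<ge> 0"
    by (intro Bochner_Integration.integral_nonneg pos)
  finally show "0 \<le> Re (\<Sum>a\<in>midxs t. \<Sum>b\<in>midxs t. cnj (v a) * (phase_kernel s a b * A a b) * v b)"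
    unfolding eq .
qed

section \<open>Compatibility with transposes, permutations and traces\<close>

text \<open>The integrands already agree for each \<open>U\<close>: a letter moved between row and
  column passes to the other, oppositely conjugated, phase.\<close>

lemma phase_kernel_partial_transpose:
  assumes "length x = length y"
  shows "phase_kernel 0 (i0, take s y @ drop s x) (j0, take s x @ drop s y)
       = phase_kernel s (i0, x) (j0, y)"
  unfolding phase_kernel_def diag_phase_def
  by (simp add: cnj_prod_list_map ac_simps)

lemma partial_transpose_phase_kernel:
  "partial_transpose t s (\<lambda>a b. phase_kernel 0 a b * \<rho> a b)
     = (\<lambda>a b. phase_kernel s a b * partial_transpose t s \<rho> a b)"
  by (auto simp: fun_eq_iff partial_transpose_def phase_kernel_partial_transpose)

text \<open>A phase with \<open>s = 0\<close> treats all positions of the list alike, so it depends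
  only on the multiset of letters.\<close>

lemma phase_kernel_permute_list:
  assumes "\<sigma> permutes {..<length j}"
  shows "phase_kernel 0 a (j0, permute_list \<sigma> j) = phase_kernel 0 a (j0, j)"
proof -
  have "prod_list (map f (permute_list \<sigma> j)) = prod_list (map f j)" for f :: "_ \<Rightarrow> complex"
    using assms by (metis mset_map mset_permute_list prod_mset_prod_list)
  thus ?thesis by (simp add: phase_kernel_def diag_phase_def)
qed

lemma phase_kernel_append:
  "phase_kernel 0 (i, x @ h) (k, y @ h) = phase_kernel 0 (i, x) (k, y)"
  unfolding phase_kernel_def
proof (intro Bochner_Integration.integral_cong refl)
  fix U :: "complex ^ 'a ^ 'a" assume "U \<in> space haar_DU"
  hence "norm (prod_list (map (\<lambda>k. cnj (U $ k $ k)) h)) = 1"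
    by (simp add: norm_prod_list_eq_1 norm_DU_diag)
  hence "prod_list (map (\<lambda>k. cnj (U $ k $ k)) h) * cnj (prod_list (map (\<lambda>k. cnj (U $ k $ k)) h)) = 1"
    by (metis complex_norm_square of_real_1 power_one)
  thus "diag_phase 0 U (i, x @ h) * cnj (diag_phase 0 U (k, y @ h))
      = diag_phase 0 U (i, x) * cnj (diag_phase 0 U (k, y))"
    by (simp add: diag_phase_def)
qed

text \<open>The kernel does not see \<open>h\<close> and leaves the sum. Since
  \<open>phase_kernel 0\<close> does not involve \<open>t\<close>, the same kernel gives the
  projections before and after tracing.\<close>

lemma partial_trace_phase_kernel:
  "partial_trace t (\<lambda>a b. phase_kernel 0 a b * \<rho> a b)
     = (\<lambda>a b. phase_kernel 0 a b * partial_trace t \<rho> a b)"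
  by (auto simp: fun_eq_iff partial_trace_def phase_kernel_append sum_distrib_left)

section \<open>Invariance under diagonal unitaries\<close>

text \<open>For fixed \<open>s\<close> and \<open>a\<close>, the phase is a character of the group
  \<open>DU\<close>.\<close>

lemma diag_phase_mult:
  fixes U V :: "complex ^ 'n::finite ^ 'n"
  assumes "U \<in> DU" "V \<in> DU"
  shows "diag_phase s (V ** U) a = diag_phase s V a * diag_phase s U a"
proof -
  have d: "(V ** U) $ k $ k = V $ k $ k * U $ k $ k" for k
    using assms by (auto simp: DU_iff diag_mat_mult) (simp add: diag_mat_def)
  have "prod_list (map (\<lambda>k. f k * g k) x) = prod_list (map f x) * prod_list (map g x)"
    for f g :: "'n \<Rightarrow> complex" and x
    by (induction x) (auto simp: ac_simps)
  thus ?thesis by (cases a) (simp add: diag_phase_def d ac_simps)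
qed

text \<open>Translating the Haar variable by \<open>V\<close> pulls the character value at
  \<open>V\<close> out of the integral.\<close>

lemma phase_kernel_invariant:
  fixes V :: "complex ^ 'n::finite ^ 'n"
  assumes V: "V \<in> DU"
  shows "diag_phase s V a * cnj (diag_phase s V b) * phase_kernel s a b = phase_kernel s a b"
proof -
  let ?f = "\<lambda>U :: complex ^ 'n ^ 'n. diag_phase s U a * cnj (diag_phase s U b)"
  have "continuous_on UNIV (\<lambda>U. V ** U)"
    by (auto simp: matrix_matrix_mult_def intro!: continuous_intros)
  moreover have "V ** U \<in> DU" if "U \<in> DU" for U
  proof -
    obtain u v where "\<And>i. norm (u i) = 1" "\<And>i. norm (v i) = 1" "U = diag_mat u" "V = diag_mat v"
      using \<open>U \<in> DU\<close> V unfolding DU_iff by metis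
    thus ?thesis
      by (auto simp: diag_mat_mult DU_iff norm_mult intro!: exI[of _ "\<lambda>i. v i * u i"])
  qed
  ultimately have "(\<lambda>U. V ** U) \<in> restrict_space borel DU \<rightarrow>\<^sub>M restrict_space borel DU"
    by (intro measurable_restrict_space2 measurable_restrict_space1 borel_measurable_continuous_onI)
      (auto simp: space_restrict_space)
  hence m: "(\<lambda>U. V ** U) \<in> haar_DU \<rightarrow>\<^sub>M haar_DU"
    by (simp cong: measurable_cong_sets)
  have "phase_kernel s a b = (\<integral>U. ?f U \<partial>distr haar_DU haar_DU (\<lambda>U. V ** U))"
    by (simp add: phase_kernel_def haar_DU_invariant[OF V])
  also have "\<dots> = (\<integral>U. ?f (V ** U) \<partial>haar_DU)"
    by (intro integral_distr m borel_measurable_integrable integrable_diag_phase)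
  also have "\<dots> = (\<integral>U. ?f V * ?f U \<partial>haar_DU)"
    by (intro Bochner_Integration.integral_cong refl) (simp add: diag_phase_mult V)
  also have "\<dots> = ?f V * phase_kernel s a b"
    by (simp add: phase_kernel_def)
  finally show ?thesis by simp
qed

lemma proj_CLDUI_in_CLDUI:
  assumes "\<rho> \<in> Herm t"
  shows "proj_CLDUI t \<rho> \<in> CLDUI t"
proof -
  have \<rho>: "\<rho> \<in> mmats t" using assms by (simp add: Herm_def)
  have H: "(\<lambda>a b. phase_kernel 0 a b * \<rho> a b) \<in> Herm t"
    by (rule Herm_phase_kernel) fact
  hence "(\<lambda>a b. phase_kernel 0 a b * \<rho> a b) \<in> mmats t" by (simp add: Herm_def)
  thus ?thesis using H
    by (simp add: CLDUI_def proj_CLDUI_eq[OF \<rho>, abs_def] U_conj_DU fun_eq_iff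
        phase_kernel_invariant flip: mult.assoc)
qed

text \<open>The integrand is constant on \<open>DU\<close>, and the Haar measure has total mass
  1.\<close>

lemma proj_CLDUI_fixes_CLDUI:
  fixes \<rho> :: "('n::finite) mmat"
  assumes "\<rho> \<in> CLDUI t"
  shows "proj_CLDUI t \<rho> = \<rho>"
proof (intro ext)
  fix a b
  interpret prob_space "haar_DU :: (complex ^ 'n ^ 'n) measure" by (rule prob_space_haar_DU)
  have "proj_CLDUI t \<rho> a b = integral\<^sup>L haar_DU (\<lambda>U :: complex ^ 'n ^ 'n. \<rho> a b)"
    unfolding proj_CLDUI_def using assms
    by (intro Bochner_Integration.integral_cong refl) (simp add: CLDUI_def)
  thus "proj_CLDUI t \<rho> a b = \<rho> a b" using prob_space by simp
qed

section \<open>Projecting certificates\<close>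

lemma DPS_certificate_proj_CLDUI:
  fixes \<rho>AB \<rho> :: "('n::finite) mmat"
  assumes "DPS_certificate t \<rho>AB \<rho>"
  shows "DPS_certificate t (proj_CLDUI 1 \<rho>AB) (proj_CLDUI t \<rho>)"
proof -
  have H: "\<rho>AB \<in> Herm 1" "\<rho> \<in> Herm t"
    and perm: "\<And>\<sigma> i0 i j0 j. \<sigma> permutes {..<t} \<Longrightarrow> length i = t \<Longrightarrow> length j = t \<Longrightarrow>
        \<rho> (i0, i) (j0, j) = \<rho> (i0, i) (j0, permute_list \<sigma> j)"
    and psd: "\<And>s. s \<le> t \<Longrightarrow> psd t (partial_transpose t s \<rho>)"
    and tr: "partial_trace t \<rho> = \<rho>AB"
    using assms unfolding DPS_certificate_def by blast+
  have p: "proj_CLDUI 1 \<rho>AB = (\<lambda>a b. phase_kernel 0 a b * \<rho>AB a b)"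
    "proj_CLDUI t \<rho> = (\<lambda>a b. phase_kernel 0 a b * \<rho> a b)"
    using H by (auto simp: fun_eq_iff Herm_def proj_CLDUI_eq)
  show ?thesis
    unfolding DPS_certificate_def p partial_transpose_phase_kernel partial_trace_phase_kernel tr
    using H by (auto intro!: Herm_phase_kernel psd_phase_kernel psd simp: perm[symmetric] phase_kernel_permute_list)
qed

theorem theorem3p1:
  fixes t :: nat and \<rho>AB \<rho>ABt :: "('n::finite) mmat"
  assumes "t \<ge> 1"
    and "\<rho>AB \<in> DPS t"
    and "DPS_certificate t \<rho>AB \<rho>ABt"
  shows "proj_CLDUI 1 \<rho>AB \<in> DPS t \<and>
         DPS_certificate t (proj_CLDUI 1 \<rho>AB) (proj_CLDUI t \<rho>ABt) \<and>
         (\<rho>AB \<in> CLDUI 1 \<longrightarrow> (\<exists>\<rho>'. DPS_certificate t \<rho>AB \<rho>' \<and> \<rho>' \<in> CLDUI t))"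
proof (intro conjI impI)
  show cert: "DPS_certificate t (proj_CLDUI 1 \<rho>AB) (proj_CLDUI t \<rho>ABt)"
    using assms(3) by (rule DPS_certificate_proj_CLDUI)
  thus "proj_CLDUI 1 \<rho>AB \<in> DPS t"
    by (auto simp: DPS_def DPS_certificate_def)
  assume "\<rho>AB \<in> CLDUI 1"
  moreover have "proj_CLDUI t \<rho>ABt \<in> CLDUI t"
    using assms(3) by (intro proj_CLDUI_in_CLDUI) (simp add: DPS_certificate_def)
  ultimately show "\<exists>\<rho>'. DPS_certificate t \<rho>AB \<rho>' \<and> \<rho>' \<in> CLDUI t"
    \<comment> \<open>The fixed-point property is applied to the bipartite matrix, turning the
      projected certificate into one for \<open>\<rho>AB\<close> itself.\<close>
    using cert by (metis proj_CLDUI_fixes_CLDUI)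
qed

end
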